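(* Let $\mathcal F$ be a simple graph family and let $\operatorname{Patch}_{\mathcal F}(z,w,u)$ be the generating function of canonically labeled $\mathcal F$-patchworks (of simple graphs). Then for all integers $n,m,t\ge0$, the number $\operatorname{SG}^{\mathcal F}_{n,m,t}$ of simple graphs with vertex set $\{1,\dots,n\}$ and $m$ edges that contain exactly $t$ $\mathcal F$-subgraphs is \[ \operatorname{SG}^{\mathcal F}_{n,m,t}= n!\,[z^n w^m u^t]\, \operatorname{Patch}_{\mathcal F}\!\left(z,\frac{w}{1+w},u-1\right) e^{z}\,(1+w)^{\binom n2}. \]
   Context: Simple graphs have vertices labeled by distinct integers and edges that are unordered pairs of distinct vertices. A simple graph family $\mathcal F$ is a set of graphs with vertex labels $1,\dots,n(H)$, closed under isomorphism; an $\mathcal F$-subgraph of $G$ is a subgraph ($V(F)\subset V(G)$, $E(F)\subset E(G)$) isomorphic to an element of $\mathcal F$. An $\mathcal F$-patchwork $P$ is a finite set (possibly empty) of distinct graphs isomorphic to elements of $\mathcal F$ (its pieces), each with arbitrary distinct integer vertex labels, where vertices of different pieces with the same label are identified, and edges of different pieces joining the same two vertices are identified. $V(P)$, $E(P)$ are the unions over pieces, $n(P)=|V(P)|$, $m(P)=|E(P)|$, $|P|$ is the number of pieces; $P$ is canonically labeled if $V(P)=\{1,\dots,n(P)\}$. Its generating function is $\operatorname{Patch}_{\mathcal F}(z,w,u)=\sum_P u^{|P|} w^{m(P)}\frac{z^{n(P)}}{n(P)!}$ over canonically labeled $\mathcal F$-patchworks. *)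

theory Defs
  imports "HOL-Computational_Algebra.Computational_Algebra"
begin

subsection \<open>Simple graphs\<close>

type_synonym graph = "int set \<times> int set set"

abbreviation verts :: "graph \<Rightarrow> int set" where "verts G \<equiv> fst G"
abbreviation edges :: "graph \<Rightarrow> int set set" where "edges G \<equiv> snd G"

definition simple_graph :: "graph \<Rightarrow> bool" where
  "simple_graph G \<longleftrightarrow> finite (verts G) \<and>
     (\<forall>e\<in>edges G. \<exists>a\<in>verts G. \<exists>b\<in>verts G. a \<noteq> b \<and> e = {a, b})"

definition graph_iso :: "graph \<Rightarrow> graph \<Rightarrow> bool" where
  "graph_iso G H \<longleftrightarrow>
     (\<exists>f. bij_betw f (verts G) (verts H) \<and> (\<lambda>e. f ` e) ` edges G = edges H)"

definition canonical_graph :: "graph \<Rightarrow> bool" where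
  "canonical_graph G \<longleftrightarrow> simple_graph G \<and> verts G = {1..int (card (verts G))}"

text \<open>Closure under isomorphism is relative to the canonically labeled graphs, since every
  member of a family has vertex labels \<open>1, \<dots>, n(H)\<close>.\<close>

definition simple_graph_family :: "graph set \<Rightarrow> bool" where
  "simple_graph_family F \<longleftrightarrow> (\<forall>H\<in>F. canonical_graph H) \<and>
     (\<forall>H\<in>F. \<forall>H'. canonical_graph H' \<and> graph_iso H H' \<longrightarrow> H' \<in> F)"

definition iso_to_member :: "graph set \<Rightarrow> graph \<Rightarrow> bool" where
  "iso_to_member F S \<longleftrightarrow> simple_graph S \<and> (\<exists>H\<in>F. graph_iso S H)"

definition family_subgraphs :: "graph set \<Rightarrow> graph \<Rightarrow> graph set" where
  "family_subgraphs F G =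
     {S. iso_to_member F S \<and> verts S \<subseteq> verts G \<and> edges S \<subseteq> edges G}"

definition SG :: "graph set \<Rightarrow> nat \<Rightarrow> nat \<Rightarrow> nat \<Rightarrow> nat" where
  "SG F n m t = card {G. simple_graph G \<and> verts G = {1..int n} \<and> card (edges G) = m \<and>
     card (family_subgraphs F G) = t}"

subsection \<open>Patchworks\<close>

text \<open>A patchwork is its set of pieces. Vertices are their labels and edges are pairs of labels,
  so the required identifications are made by taking plain unions.\<close>

definition patchwork :: "graph set \<Rightarrow> graph set \<Rightarrow> bool" where
  "patchwork F P \<longleftrightarrow> finite P \<and> (\<forall>S\<in>P. iso_to_member F S)"

definition patch_verts :: "graph set \<Rightarrow> int set" where
  "patch_verts P = (\<Union>S\<in>P. verts S)"

definition patch_edges :: "graph set \<Rightarrow> int set set" where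
  "patch_edges P = (\<Union>S\<in>P. edges S)"

definition canonical_patchworks :: "graph set \<Rightarrow> graph set set" where
  "canonical_patchworks F =
     {P. patchwork F P \<and> patch_verts P = {1..int (card (patch_verts P))}}"

subsection \<open>Generating functions\<close>

text \<open>There are only finitely many canonically labeled patchworks on \<open>n\<close> vertices, so the
  coefficient of \<open>z\<^sup>n\<close> is a polynomial in \<open>u\<close>, which is what makes the substitution
  \<open>u \<mapsto> u - 1\<close> meaningful. Series in \<open>z, w, u\<close> are therefore power series in \<open>z\<close> over polynomials
  in \<open>u\<close> over power series in \<open>w\<close>.\<close>

type_synonym zuw_series = "rat fps poly fps"

definition coeff_zwu :: "zuw_series \<Rightarrow> nat \<Rightarrow> nat \<Rightarrow> nat \<Rightarrow> rat" where
  "coeff_zwu A n m t = fps_nth (coeff (fps_nth A n) t) m"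

definition z_series :: "rat fps \<Rightarrow> zuw_series" where
  "z_series f = Abs_fps (\<lambda>n. [:fps_const (fps_nth f n):])"

definition w_series :: "rat fps \<Rightarrow> zuw_series" where
  "w_series f = fps_const [:f:]"

text \<open>The substitution \<open>w \<mapsto> a\<close>, \<open>u \<mapsto> b\<close>; it is only meaningful if the series \<open>a\<close> in \<open>w\<close> has
  zero constant term.\<close>

definition subst_wu :: "rat fps \<Rightarrow> rat fps poly \<Rightarrow> zuw_series \<Rightarrow> zuw_series" where
  "subst_wu a b A = Abs_fps (\<lambda>n. pcompose (map_poly (\<lambda>f. fps_compose f a) (fps_nth A n)) b)"

definition Patch :: "graph set \<Rightarrow> zuw_series" where
  "Patch F = Abs_fps (\<lambda>n. \<Sum>P | P \<in> canonical_patchworks F \<and> card (patch_verts P) = n.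
     monom (fps_X ^ card (patch_edges P) * fps_const (1 / fact n)) (card P))"

lemma finite_canonical_patchworks:
  "finite {P. P \<in> canonical_patchworks F \<and> card (patch_verts P) = n}"
proof (rule finite_subset)
  show "{P. P \<in> canonical_patchworks F \<and> card (patch_verts P) = n}
    \<subseteq> Pow (Pow {1..int n} \<times> Pow (Pow {1..int n}))"
  proof (intro subsetI PowI)
    fix P S
    assume P: "P \<in> {P. P \<in> canonical_patchworks F \<and> card (patch_verts P) = n}" and S: "S \<in> P"
    have "patch_verts P = {1..int n}" and simple: "simple_graph S"
      using P S by (auto simp: canonical_patchworks_def patchwork_def iso_to_member_def)
    then have V: "verts S \<subseteq> {1..int n}"
      using S by (auto simp: patch_verts_def)
    moreover have "edges S \<subseteq> Pow (verts S)"
      using simple by (auto simp: simple_graph_def)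
    ultimately have "edges S \<subseteq> Pow {1..int n}"
      by blast
    with V show "S \<in> Pow {1..int n} \<times> Pow (Pow {1..int n})"
      by (simp add: mem_Times_iff)
  qed
qed simp

end

(* Inclusion-exclusion: writing u = 1 + (u - 1), a graph with t subgraphs from the family
   contributes u^t, the sum of (u - 1)^|P| over all sets P of such subgraphs, and these P are exactly
   the patchworks contained in the graph.  Exchanging the sums, a patchwork P within {1..n} with e
   edges is contained in graphs of total weight
     w^e (1 + w)^((n choose 2) - e) = (w / (1 + w))^e (1 + w)^(n choose 2).
   By relabeling, the patchworks on any k of the n vertices contribute like the canonically labeled
   ones, and the factor n choose k is what multiplication by e^z produces. *)

theory Submission
  imports Defs
begin

section \<open>Simple graphs and sets of their \<open>F\<close>-subgraphs\<close>

lemma simple_graph_iff: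
  "simple_graph G \<longleftrightarrow> finite (verts G) \<and> edges G \<subseteq> {e. e \<subseteq> verts G \<and> card e = 2}"
proof -
  have "(\<exists>a\<in>V. \<exists>b\<in>V. a \<noteq> b \<and> e = {a, b}) \<longleftrightarrow> e \<subseteq> V \<and> card e = 2" for V e :: "int set"
    by (auto simp: card_2_iff)
  then show ?thesis
    by (auto simp: simple_graph_def)
qed

lemma finite_edges:
  assumes "simple_graph G"
  shows "finite (edges G)"
  using assms by (auto simp: simple_graph_iff intro: finite_subset[of _ "Pow (verts G)"])

lemma finite_family_subgraphs:
  assumes "simple_graph G"
  shows "finite (family_subgraphs F G)"
proof (rule finite_subset)
  show "family_subgraphs F G \<subseteq> Pow (verts G) \<times> Pow (edges G)"
    by (auto simp: family_subgraphs_def)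
  show "finite (Pow (verts G) \<times> Pow (edges G))"
    using assms finite_edges[OF assms] by (simp add: simple_graph_def)
qed

text \<open>A union is contained in a set exactly when every piece is, and finiteness of
  \<open>P\<close> is automatic because a finite graph has only finitely many subgraphs. This turns
  the index sets of inclusion-exclusion into patchworks.\<close>

lemma subset_family_subgraphs_iff:
  assumes "simple_graph G"
  shows "P \<subseteq> family_subgraphs F G \<longleftrightarrow>
    patchwork F P \<and> patch_verts P \<subseteq> verts G \<and> patch_edges P \<subseteq> edges G"
proof -
  have "P \<subseteq> family_subgraphs F G \<longleftrightarrow> (\<forall>S\<in>P. iso_to_member F S) \<and>
      patch_verts P \<subseteq> verts G \<and> patch_edges P \<subseteq> edges G"
    unfolding family_subgraphs_def patch_verts_def patch_edges_def by blast
  moreover have "finite P" if "P \<subseteq> family_subgraphs F G"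
    using that finite_family_subgraphs[OF assms] by (rule finite_subset)
  ultimately show ?thesis
    unfolding patchwork_def by blast
qed

section \<open>Relabeling of patchworks\<close>

definition relabel :: "(int \<Rightarrow> int) \<Rightarrow> graph \<Rightarrow> graph" where
  "relabel f S = (f ` verts S, (`) f ` edges S)"

lemma relabel_relabel: "relabel f (relabel g S) = relabel (f \<circ> g) S"
  by (simp add: relabel_def image_image image_comp)

lemma relabel_id: "relabel id S = S"
  by (simp add: relabel_def)

lemma inj_relabel:
  assumes "inj f"
  shows "inj (relabel f)"
proof (rule inj_on_inverseI)
  show "relabel (inv f) (relabel f S) = S" for S
    using assms by (simp add: relabel_relabel relabel_id)
qed

text \<open>An isomorphism from \<open>S\<close> to a member of \<open>F\<close>, precomposed with
  \<open>inv f\<close>, is one from the relabeled graph.\<close>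

lemma iso_to_member_relabel:
  assumes "inj f" and "iso_to_member F S"
  shows "iso_to_member F (relabel f S)"
proof -
  from assms(2) obtain H g where S: "simple_graph S" and "H \<in> F"
    and g: "bij_betw g (verts S) (verts H)" "(`) g ` edges S = edges H"
    by (auto simp: iso_to_member_def graph_iso_def)
  have "bij_betw (inv f) (f ` verts S) (verts S)"
    using assms(1) by (auto simp: bij_betw_def image_image intro!: inj_on_inv_into)
  then have "bij_betw (g \<circ> inv f) (verts (relabel f S)) (verts H)"
    using g(1) by (auto simp: relabel_def intro: bij_betw_trans)
  moreover have "(`) (g \<circ> inv f) ` edges (relabel f S) = edges H"
    using assms(1) g(2) by (simp add: relabel_def image_image image_comp comp_assoc)
  moreover have "simple_graph (relabel f S)"
    using S assms(1) by (auto simp: simple_graph_iff relabel_def card_image inj_on_subset)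
  ultimately show ?thesis
    using \<open>H \<in> F\<close> unfolding iso_to_member_def graph_iso_def by blast
qed

definition patchworks_on :: "graph set \<Rightarrow> int set \<Rightarrow> graph set set" where
  "patchworks_on F A = {P. patchwork F P \<and> patch_verts P = A}"

lemma patchworks_on_relabel:
  assumes "inj f" and "P \<in> patchworks_on F A"
  shows "relabel f ` P \<in> patchworks_on F (f ` A)"
  using assms iso_to_member_relabel[OF assms(1)]
  by (auto simp: patchworks_on_def patchwork_def patch_verts_def relabel_def)

lemma patch_edges_relabel: "patch_edges (relabel f ` P) = (`) f ` patch_edges P"
  by (auto simp: patch_edges_def relabel_def)

text \<open>A bijection from \<open>A\<close> to \<open>B\<close> is completed by one from
  \<open>B - A\<close> to \<open>A - B\<close>, which have equal size, and by the identity
  elsewhere. The facts on \<open>relabel\<close> ask for injectivity on all integers, so a bijection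
  between \<open>A\<close> and \<open>B\<close> alone would not do.\<close>

lemma ex_bij_extending:
  assumes "finite A" "finite B" "card A = card B"
  obtains f :: "'a \<Rightarrow> 'a" where "bij f" "f ` A = B"
proof -
  obtain h where h: "bij_betw h A B"
    using assms by (meson finite_same_card_bij)
  have "card (B - A) = card (A - B)"
    using assms by (simp add: card_Diff_subset_Int Int_commute)
  then obtain g where g: "bij_betw g (B - A) (A - B)"
    using assms by (meson finite_same_card_bij finite_Diff)
  define f where "f x = (if x \<in> A then h x else if x \<in> B - A then g x else x)" for x
  have "bij_betw f A B"
    using h by (simp add: f_def cong: bij_betw_cong)
  moreover have "bij_betw f (B - A) (A - B)"
    using g by (subst bij_betw_cong[of _ _ g]) (auto simp: f_def)
  moreover have "bij_betw f (- (A \<union> B)) (- (A \<union> B))"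
    by (subst bij_betw_cong[of _ _ id]) (auto simp: f_def)
  ultimately have "bij_betw f (A \<union> (B - A) \<union> - (A \<union> B)) (B \<union> (A - B) \<union> - (A \<union> B))"
    by (intro bij_betw_combine) auto
  moreover have "A \<union> (B - A) \<union> - (A \<union> B) = UNIV" "B \<union> (A - B) \<union> - (A \<union> B) = UNIV"
    by auto
  ultimately have "bij f"
    by simp
  then show thesis
    using that \<open>bij_betw f A B\<close> by (simp add: bij_betw_def)
qed

text \<open>A permutation of the integers taking \<open>A\<close> to \<open>B\<close> matches the
  patchworks on both sets and preserves the numbers of edges and of pieces, on which alone the
  weight depends.\<close>

lemma sum_patchworks_on_cong_card:
  assumes "finite A" "finite B" "card A = card B"
  shows "(\<Sum>P\<in>patchworks_on F A. g (card (patch_edges P)) (card P)) =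
    (\<Sum>P\<in>patchworks_on F B. g (card (patch_edges P)) (card P))"
proof -
  obtain f where f: "bij f" "f ` A = B"
    using ex_bij_extending[OF assms] by blast
  then have inj: "inj f" "inj (inv f)" and B: "inv f ` B = A"
    by (auto simp: bij_is_inj bij_is_surj surj_imp_inj_inv image_image)
  have inv: "relabel (inv f) ` relabel f ` P = P" "relabel f ` relabel (inv f) ` P = P" for P
    using f(1) by (simp_all add: image_image relabel_relabel relabel_id bij_is_inj bij_is_surj
        surj_iff[THEN iffD1])
  show ?thesis
  proof (rule sum.reindex_bij_witness[where i = "image (relabel (inv f))" and j = "image (relabel f)"])
    fix P assume P: "P \<in> patchworks_on F A"
    show "relabel f ` P \<in> patchworks_on F B"
      using patchworks_on_relabel[OF inj(1) P] f(2) by simp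
    have "card (relabel f ` P) = card P"
      using inj_relabel[OF inj(1)] by (simp add: card_image inj_on_subset)
    moreover have "card (patch_edges (relabel f ` P)) = card (patch_edges P)"
      unfolding patch_edges_relabel using inj(1)
      by (intro card_image inj_on_image) (rule inj_on_subset[OF _ subset_UNIV])
    ultimately show "g (card (patch_edges (relabel f ` P))) (card (relabel f ` P)) =
      g (card (patch_edges P)) (card P)"
      by simp
  next
    fix P assume P: "P \<in> patchworks_on F B"
    show "relabel (inv f) ` P \<in> patchworks_on F A"
      using patchworks_on_relabel[OF inj(2) P] B by simp
  qed (simp_all add: inv)
qed

section \<open>Patchworks sorted by vertex set\<close>

lemma canonical_patchworks_eq:
  "{P. P \<in> canonical_patchworks F \<and> card (patch_verts P) = n} = patchworks_on F {1..int n}"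
proof -
  have "card {1..int n} = n"
    by simp
  then have "A = {1..int (card A)} \<and> card A = n \<longleftrightarrow> A = {1..int n}" for A
    by metis
  then show ?thesis
    unfolding canonical_patchworks_def patchworks_on_def by blast
qed

lemma finite_patchworks_on:
  assumes "finite A"
  shows "finite (patchworks_on F A)"
proof (rule finite_subset)
  show "patchworks_on F A \<subseteq> Pow (Pow A \<times> Pow (Pow A))"
  proof (intro subsetI PowI)
    fix P S assume P: "P \<in> patchworks_on F A" and S: "S \<in> P"
    then have "verts S \<subseteq> A" and "edges S \<subseteq> Pow (verts S)"
      by (auto simp: patchworks_on_def patchwork_def patch_verts_def iso_to_member_def
          simple_graph_iff)
    then show "S \<in> Pow A \<times> Pow (Pow A)"
      by (auto simp: mem_Times_iff)
  qed
qed (use assms in simp)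

text \<open>After sorting by the exact vertex set \<open>B\<close>, the inner sum depends only on
  \<open>card B\<close>, and there are \<open>n choose k\<close> sets \<open>B\<close> of size
  \<open>k\<close>.\<close>

lemma sum_patchworks_within:
  fixes g :: "nat \<Rightarrow> nat \<Rightarrow> 'a::comm_ring_1"
  shows "(\<Sum>P | patchwork F P \<and> patch_verts P \<subseteq> {1..int n}. g (card (patch_edges P)) (card P)) =
    (\<Sum>k\<le>n. of_nat (n choose k) *
      (\<Sum>P\<in>patchworks_on F {1..int k}. g (card (patch_edges P)) (card P)))"
proof -
  let ?w = "\<lambda>P. g (card (patch_edges P)) (card P)"
  let ?A = "{1..int n}"
  have "(\<Sum>P | patchwork F P \<and> patch_verts P \<subseteq> ?A. ?w P) =
      (\<Sum>P\<in>(\<Union>B\<in>Pow ?A. patchworks_on F B). ?w P)"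
    by (rule sum.cong) (auto simp: patchworks_on_def)
  also have "\<dots> = (\<Sum>B\<in>Pow ?A. \<Sum>P\<in>patchworks_on F B. ?w P)"
  proof (rule sum.UNION_disjoint)
    show "\<forall>B\<in>Pow ?A. finite (patchworks_on F B)"
      by (auto intro: finite_patchworks_on finite_subset[of _ ?A])
  qed (auto simp: patchworks_on_def)
  also have "\<dots> = (\<Sum>B\<in>Pow ?A. \<Sum>P\<in>patchworks_on F {1..int (card B)}. ?w P)"
    by (intro sum.cong refl sum_patchworks_on_cong_card)
      (auto intro: finite_subset[of _ ?A])
  also have "\<dots> = (\<Sum>k\<le>n. \<Sum>B | B \<in> Pow ?A \<and> card B = k.
      \<Sum>P\<in>patchworks_on F {1..int (card B)}. ?w P)"
    by (rule sum.group[symmetric]) (auto intro: card_mono[of ?A, simplified])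
  also have "\<dots> = (\<Sum>k\<le>n. \<Sum>B | B \<subseteq> ?A \<and> card B = k.
      \<Sum>P\<in>patchworks_on F {1..int k}. ?w P)"
    by (intro sum.cong) auto
  finally show ?thesis
    by (simp add: n_subsets)
qed

section \<open>Inclusion-exclusion over edge sets\<close>

text \<open>A set between \<open>Q\<close> and \<open>K\<close> is \<open>Q\<close> together with an
  arbitrary subset of \<open>K - Q\<close>, so each element of \<open>K - Q\<close> contributes a
  factor \<open>1 + x\<close>.\<close>

lemma sum_supersets_power_card:
  fixes x :: "'a::comm_ring_1"
  assumes "finite K" "Q \<subseteq> K"
  shows "(\<Sum>E | E \<subseteq> K \<and> Q \<subseteq> E. x ^ card E) = x ^ card Q * (1 + x) ^ (card K - card Q)"
proof -
  have fin: "finite E" if "E \<subseteq> K" for E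
    using that assms(1) finite_subset by blast
  have "(\<Sum>E | E \<subseteq> K \<and> Q \<subseteq> E. x ^ card E) = (\<Sum>D\<in>Pow (K - Q). x ^ card Q * x ^ card D)"
  proof (rule sum.reindex_bij_witness[where i = "\<lambda>D. D \<union> Q" and j = "\<lambda>E. E - Q"])
    fix E assume E: "E \<in> {E. E \<subseteq> K \<and> Q \<subseteq> E}"
    then have "card E = card Q + card (E - Q)"
      using fin by (metis (no_types, lifting) card_Diff_subset card_mono le_add_diff_inverse
          finite_subset mem_Collect_eq)
    then show "x ^ card Q * x ^ card (E - Q) = x ^ card E"
      by (simp add: power_add)
  qed (use assms in auto)
  also have "\<dots> = x ^ card Q * (\<Sum>D\<in>Pow (K - Q). x ^ card D)"
    by (simp add: sum_distrib_left)
  \<comment> \<open>\<open>prod_add\<close> expands the product of the factors \<open>x + 1\<close>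
    over \<open>K - Q\<close> into a sum over its subsets.\<close>
  also have "(\<Sum>D\<in>Pow (K - Q). x ^ card D) = (1 + x) ^ card (K - Q)"
    using prod_add[of "K - Q" "\<lambda>_. x" "\<lambda>_. 1"] assms(1) by (simp add: add.commute)
  finally show ?thesis
    using assms by (simp add: card_Diff_subset finite_subset)
qed

text \<open>The edge set of the complete graph on \<open>{1..int n}\<close>.\<close>

definition all_edges :: "nat \<Rightarrow> int set set" where
  "all_edges n = {e. e \<subseteq> {1..int n} \<and> card e = 2}"

lemma finite_all_edges: "finite (all_edges n)"
  by (rule finite_subset[of _ "Pow {1..int n}"]) (auto simp: all_edges_def)

lemma card_all_edges: "card (all_edges n) = n choose 2"
  by (simp add: all_edges_def n_subsets)

lemma simple_graph_on_iff: "simple_graph ({1..int n}, E) \<longleftrightarrow> E \<subseteq> all_edges n"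
  by (simp add: simple_graph_iff all_edges_def)

text \<open>With the vertex set fixed, a graph is determined by its edge set.\<close>

lemma SG_eq_card_edge_sets:
  "SG F n m t = card {E. E \<subseteq> all_edges n \<and> card E = m \<and>
     card (family_subgraphs F ({1..int n}, E)) = t}" (is "_ = card ?S")
proof -
  have "{G. simple_graph G \<and> verts G = {1..int n} \<and> card (edges G) = m \<and>
      card (family_subgraphs F G) = t} = Pair {1..int n} ` ?S"
    by (auto simp: simple_graph_on_iff[symmetric] image_iff)
  then show ?thesis
    by (simp add: SG_def card_image inj_on_def)
qed

text \<open>Consequently a patchwork has at most \<open>n choose 2\<close> edges, so the subtraction
  in the exponent of \<open>1 + x\<close> is never truncated.\<close>

lemma patch_edges_subset_all_edges:
  assumes "patchwork F P" "patch_verts P \<subseteq> {1..int n}"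
  shows "patch_edges P \<subseteq> all_edges n"
  using assms
  by (fastforce simp: patchwork_def patch_verts_def patch_edges_def iso_to_member_def
      simple_graph_iff all_edges_def)

lemma finite_patchworks_within:
  "finite {P. patchwork F P \<and> patch_verts P \<subseteq> {1..int n}}"
proof (rule finite_subset)
  show "{P. patchwork F P \<and> patch_verts P \<subseteq> {1..int n}}
      \<subseteq> (\<Union>A\<in>Pow {1..int n}. patchworks_on F A)"
    by (auto simp: patchworks_on_def)
qed (auto intro: finite_patchworks_on finite_subset[of _ "{1..int n}"])

text \<open>Here \<open>x\<close> marks edges and \<open>y\<close> plays the role of
  \<open>u - 1\<close>; both sides count pairs of a graph and a patchwork contained in it.\<close>

lemma sum_graphs_eq_sum_patchworks:
  fixes x y :: "'a::comm_ring_1"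
  shows "(\<Sum>E\<in>Pow (all_edges n). x ^ card E * (1 + y) ^ card (family_subgraphs F ({1..int n}, E))) =
    (\<Sum>P | patchwork F P \<and> patch_verts P \<subseteq> {1..int n}.
      x ^ card (patch_edges P) * (1 + x) ^ ((n choose 2) - card (patch_edges P)) * y ^ card P)"
    (is "?lhs = sum _ ?PW")
proof -
  let ?sub = "\<lambda>E. family_subgraphs F ({1..int n}, E)"
  have Pow_sub: "Pow (?sub E) = {P \<in> ?PW. patch_edges P \<subseteq> E}" if "E \<in> Pow (all_edges n)" for E
  proof -
    have "simple_graph ({1..int n}, E)"
      using that by (simp add: simple_graph_on_iff)
    then show ?thesis
      by (simp add: Pow_def subset_family_subgraphs_iff conj_assoc del: atLeastAtMost_iff)
  qed
  \<comment> \<open>The binomial expansion, indexed by the sets of \<open>F\<close>-subgraphs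
    themselves instead of by their sizes.\<close>
  have "(1 + y) ^ card (?sub E) = (\<Sum>P\<in>Pow (?sub E). y ^ card P)"
    if "E \<in> Pow (all_edges n)" for E
    using prod_add[of "?sub E" "\<lambda>_. y" "\<lambda>_. 1"] that
    by (simp add: finite_family_subgraphs simple_graph_on_iff add.commute)
  then have "?lhs = (\<Sum>E\<in>Pow (all_edges n). \<Sum>P | P \<in> ?PW \<and> patch_edges P \<subseteq> E.
      x ^ card E * y ^ card P)"
    by (intro sum.cong) (simp_all add: Pow_sub sum_distrib_left)
  \<comment> \<open>For a fixed \<open>P\<close> the inner sum now runs over the edge sets
    containing \<open>patch_edges P\<close>, which \<open>sum_supersets_power_card\<close>
    evaluates.\<close>
  also have "\<dots> = (\<Sum>P\<in>?PW. \<Sum>E | E \<in> Pow (all_edges n) \<and> patch_edges P \<subseteq> E.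
      x ^ card E * y ^ card P)"
    by (rule sum.swap_restrict) (simp_all add: finite_all_edges finite_patchworks_within)
  also have "\<dots> = (\<Sum>P\<in>?PW. (\<Sum>E | E \<subseteq> all_edges n \<and> patch_edges P \<subseteq> E. x ^ card E) * y ^ card P)"
    by (simp add: sum_distrib_right)
  also have "\<dots> = (\<Sum>P\<in>?PW.
      x ^ card (patch_edges P) * (1 + x) ^ ((n choose 2) - card (patch_edges P)) * y ^ card P)"
    by (intro sum.cong)
      (auto simp: sum_supersets_power_card finite_all_edges patch_edges_subset_all_edges card_all_edges)
  finally show ?thesis .
qed

section \<open>Coefficients of the generating functions\<close>

lemma pcompose_monom: "pcompose (monom c n) b = [:c:] * b ^ n"
  by (induction n) (simp_all add: monom_0 monom_Suc pcompose_pCons)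

lemma map_poly_fps_compose_sum:
  "map_poly (\<lambda>f. fps_compose f a) (sum p A) = (\<Sum>i\<in>A. map_poly (\<lambda>f. fps_compose f a) (p i))"
  by (rule poly_eqI) (simp add: coeff_map_poly coeff_sum fps_compose_sum_distrib)

lemma subst_Patch_nth:
  assumes "fps_nth a 0 = 0"
  shows "fps_nth (subst_wu a b (Patch F)) k = [:fps_const (1 / fact k):] *
    (\<Sum>P\<in>patchworks_on F {1..int k}. [:a:] ^ card (patch_edges P) * b ^ card P)"
proof -
  \<comment> \<open>Since \<open>a\<close> has zero constant term, composition with \<open>a\<close>
    is multiplicative and sends \<open>fps_X\<close> to \<open>a\<close>.\<close>
  have "map_poly (\<lambda>f. fps_compose f a) (monom (fps_X ^ e * fps_const c) j) =
      monom (a ^ e * fps_const c) j" for e c j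
    using assms by (simp add: map_poly_monom fps_compose_mult_distrib fps_compose_power[symmetric])
  then show ?thesis
    by (simp add: subst_wu_def Patch_def canonical_patchworks_eq map_poly_fps_compose_sum
        pcompose_sum pcompose_monom sum_distrib_left poly_const_pow mult_ac)
qed

text \<open>The factor \<open>w_series f\<close> is constant in \<open>z\<close>, so only the
  exponential series, with coefficients \<open>1 / fact (n - k)\<close>, enters the
  convolution.\<close>

lemma product_nth:
  fixes A :: zuw_series
  shows "fps_nth (A * z_series (fps_exp 1) * w_series f) n =
    (\<Sum>k\<le>n. fps_nth A k * [:fps_const (1 / fact (n - k)):]) * [:f:]"
  unfolding w_series_def fps_mult_right_const_nth
  by (simp add: z_series_def fps_mult_nth atLeast0AtMost)

text \<open>The three factors come from the leading \<open>n!\<close>, from the normalization in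
  \<open>Patch\<close> and from \<open>e^z\<close>.\<close>

lemma fact_mult_inverse_facts:
  assumes "k \<le> n"
  shows "[:fps_const (fact n):] * [:fps_const (1 / fact k):] * [:fps_const (1 / fact (n - k)):] =
    (of_nat (n choose k) :: rat fps poly)"
  using assms by (simp add: of_nat_poly fps_of_nat[symmetric] binomial_fact)

text \<open>Out of the \<open>N\<close> factors \<open>1 + fps_X\<close>, \<open>e\<close> cancel
  the denominators.\<close>

lemma power_X_div_one_plus_X:
  assumes "e \<le> N"
  shows "(fps_X / (1 + fps_X)) ^ e * (1 + fps_X) ^ N = (fps_X ^ e * (1 + fps_X) ^ (N - e) :: rat fps)"
proof -
  define a where "a = fps_X / (1 + fps_X :: rat fps)"
  \<comment> \<open>The constant term of \<open>1 + fps_X\<close> is 1, so this series is a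
    unit.\<close>
  have "a * (1 + fps_X) = fps_X"
    by (simp add: a_def fps_divide_unit mult.assoc inverse_mult_eq_1)
  moreover have "a ^ e * (1 + fps_X) ^ N = (a * (1 + fps_X)) ^ e * (1 + fps_X) ^ (N - e)"
    using assms by (simp add: power_mult_distrib mult.assoc flip: power_add)
  ultimately show ?thesis
    by (simp add: a_def)
qed

theorem theorem5p4:
  fixes F :: "graph set" and n m t :: nat
  assumes "simple_graph_family F"
  shows "of_nat (SG F n m t) =
    fact n * coeff_zwu
      (subst_wu (fps_X / (1 + fps_X)) [:-1, 1:] (Patch F)
        * z_series (fps_exp 1) * w_series ((1 + fps_X) ^ (n choose 2))) n m t"
proof -
  let ?N = "n choose 2"
  let ?a = "fps_X / (1 + fps_X) :: rat fps" and ?y = "[:-1, 1:] :: rat fps poly"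
  \<comment> \<open>The variable \<open>w\<close>, seen as a constant polynomial in
    \<open>u\<close>.\<close>
  let ?x = "[:fps_X:] :: rat fps poly"
  let ?sub = "\<lambda>E. family_subgraphs F ({1..int n}, E)"
  let ?A = "subst_wu ?a ?y (Patch F)"
  let ?PW = "{P. patchwork F P \<and> patch_verts P \<subseteq> {1..int n}}"
  let ?S = "\<lambda>k. \<Sum>P\<in>patchworks_on F {1..int k}. [:?a:] ^ card (patch_edges P) * ?y ^ card P"
  have a0: "fps_nth ?a 0 = 0"
    by (simp add: fps_divide_unit)
  have le: "card (patch_edges P) \<le> ?N" if "P \<in> ?PW" for P
    using that by (metis (mono_tags, lifting) card_all_edges card_mono finite_all_edges
        mem_Collect_eq patch_edges_subset_all_edges)
  \<comment> \<open>The factor \<open>n!\<close> is moved inside, before coefficients in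
    \<open>u\<close> and \<open>w\<close> are taken, so that the factorials combine to binomial
    coefficients.\<close>
  have "[:fps_const (fact n):] * fps_nth (?A * z_series (fps_exp 1) * w_series ((1 + fps_X) ^ ?N)) n =
      (\<Sum>k\<le>n. ([:fps_const (fact n):] * [:fps_const (1 / fact k):] * [:fps_const (1 / fact (n - k)):])
        * ?S k) * [:(1 + fps_X) ^ ?N:]"
    unfolding product_nth subst_Patch_nth[OF a0]
    by (simp only: sum_distrib_left sum_distrib_right mult_ac)
  also have "\<dots> = (\<Sum>k\<le>n. of_nat (n choose k) * ?S k) * [:(1 + fps_X) ^ ?N:]"
    by (intro arg_cong2[of _ _ _ _ "(*)"] sum.cong refl) (simp only: fact_mult_inverse_facts atMost_iff)
  also have "\<dots> = (\<Sum>P\<in>?PW. [:?a:] ^ card (patch_edges P) * ?y ^ card P) * [:(1 + fps_X) ^ ?N:]"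
    by (subst sum_patchworks_within) simp
  also have "\<dots> = (\<Sum>P\<in>?PW. [:?a ^ card (patch_edges P) * (1 + fps_X) ^ ?N:] * ?y ^ card P)"
    unfolding sum_distrib_right by (intro sum.cong refl) (simp add: poly_const_pow mult_ac)
  also have "\<dots> = (\<Sum>P\<in>?PW.
      ?x ^ card (patch_edges P) * (1 + ?x) ^ (?N - card (patch_edges P)) * ?y ^ card P)"
    using le by (intro sum.cong refl)
      (simp add: power_X_div_one_plus_X, simp add: poly_const_pow one_pCons mult.commute)
  also have "\<dots> = (\<Sum>E\<in>Pow (all_edges n). ?x ^ card E * (1 + ?y) ^ card (?sub E))"
    by (rule sum_graphs_eq_sum_patchworks[symmetric])
  \<comment> \<open>Because \<open>1 + ?y\<close> is the variable \<open>u\<close> itself, each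
    graph contributes a single monomial in \<open>w\<close> and \<open>u\<close>.\<close>
  also have "\<dots> = (\<Sum>E\<in>Pow (all_edges n). monom (fps_X ^ card E) (card (?sub E)))"
    by (simp add: poly_const_pow one_pCons monom_altdef)
  finally have *: "[:fps_const (fact n):] *
      fps_nth (?A * z_series (fps_exp 1) * w_series ((1 + fps_X) ^ ?N)) n = \<dots>" .
  have "fact n * coeff_zwu (?A * z_series (fps_exp 1) * w_series ((1 + fps_X) ^ ?N)) n m t =
      fps_nth (coeff ([:fps_const (fact n):] *
        fps_nth (?A * z_series (fps_exp 1) * w_series ((1 + fps_X) ^ ?N)) n) t) m"
    by (simp add: coeff_zwu_def)
  \<comment> \<open>Reading off one coefficient turns each monomial into the indicator of the graphs
    to be counted.\<close>
  also have "\<dots> = (\<Sum>E\<in>Pow (all_edges n). if card E = m \<and> card (?sub E) = t then 1 else 0)"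
    unfolding * by (auto simp: coeff_sum fps_sum_nth intro!: sum.cong)
  also have "\<dots> = of_nat (SG F n m t)"
    by (simp add: SG_eq_card_edge_sets sum.If_cases finite_all_edges Int_def)
  finally show ?thesis
    by (rule sym)
qed

end
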